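(* Let $q$ and $n$ be coprime positive integers. Let $\mathcal{N}$ be the set of cyclic necklaces of length $n$ whose beads are colored from a set of $q$ colors, i.e. the set of orbits of functions $\{1,\dots,n\}\to\{1,\dots,q\}$ under the action of the cyclic group of order $n$ rotating the domain. Let $\mathcal{F}$ be the set of finite multisets (of any size, including the empty multiset) of elements of $\mathbb{Z}/n\mathbb{Z}$ whose elements sum to $0$ and in which every element has multiplicity strictly less than $q$. Then $$|\mathcal{N}|=|\mathcal{F}|=\frac{1}{n}\sum_{e\mid n}\phi(e)\,q^{n/e},$$ where $\phi$ is Euler's totient function. *)

theory Defs
  imports
    "HOL-Algebra.Elementary_Groups"
    "HOL-Algebra.Group_Action"
    "HOL-Library.Multiset"
    "HOL-Number_Theory.Number_Theory"
begin

definition colorings :: "nat \<Rightarrow> nat \<Rightarrow> (nat \<Rightarrow> nat) set" where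
  "colorings q n = {1..n} \<rightarrow>\<^sub>E {1..q}"

text \<open>
  The residue class \<open>k\<close> sends a coloring \<open>f\<close> to \<open>i \<mapsto> f (i + k)\<close>, with \<open>i + k\<close> reduced modulo \<open>n\<close>
  to its representative in \<open>{1..n}\<close>. The outer restriction to \<open>colorings q n\<close> is what
  \<^const>\<open>BijGroup\<close> requires of the values of an action.
\<close>
definition rotation :: "nat \<Rightarrow> nat \<Rightarrow> int \<Rightarrow> (nat \<Rightarrow> nat) \<Rightarrow> (nat \<Rightarrow> nat)" where
  "rotation q n k = (\<lambda>f\<in>colorings q n. \<lambda>i\<in>{1..n}. f (nat ((int i - 1 + k) mod int n) + 1))"

definition necklaces :: "nat \<Rightarrow> nat \<Rightarrow> (nat \<Rightarrow> nat) set set" where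
  "necklaces q n = orbits (integer_mod_group n) (colorings q n) (rotation q n)"

text \<open>
  Elements of \<open>\<int>/n\<int>\<close> are represented by the carrier \<open>{0..<int n}\<close> of \<^term>\<open>integer_mod_group n\<close>
  (for \<open>n > 0\<close>).
\<close>
definition zero_sum_multisets :: "nat \<Rightarrow> nat \<Rightarrow> int multiset set" where
  "zero_sum_multisets q n =
     {M. set_mset M \<subseteq> carrier (integer_mod_group n) \<and>
         [\<Sum>\<^sub># M = 0] (mod int n) \<and>
         (\<forall>x. count M x < q)}"

lemma rotation_in_colorings:
  assumes "0 < n" "f \<in> colorings q n"
  shows "rotation q n k f \<in> colorings q n"
proof -
  have "nat ((int i - 1 + k) mod int n) + 1 \<in> {1..n}" for i
  proof -
    have "(int i - 1 + k) mod int n < int n" using assms by simp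
    moreover have "(int i - 1 + k) mod int n \<ge> 0" using assms by simp
    ultimately show ?thesis by (simp add: nat_less_iff Suc_le_eq)
  qed
  then show ?thesis
    using assms unfolding rotation_def colorings_def by (auto simp del: atLeastAtMost_iff)
qed

lemma rotation_add:
  assumes "0 < n" "f \<in> colorings q n"
  shows "rotation q n ((k + l) mod int n) f = rotation q n k (rotation q n l f)"
proof
  fix i
  let ?j = "nat ((int i - 1 + k) mod int n) + 1"
  show "rotation q n ((k + l) mod int n) f i = rotation q n k (rotation q n l f) i"
  proof (cases "i \<in> {1..n}")
    case True
    have "0 \<le> (int i - 1 + k) mod int n" "(int i - 1 + k) mod int n < int n"
      using assms by simp_all
    then have j: "?j \<in> {1..n}" "int ?j - 1 = (int i - 1 + k) mod int n"
      by (auto simp: nat_less_iff Suc_le_eq)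
    have "rotation q n k (rotation q n l f) i = rotation q n l f ?j"
      using True rotation_in_colorings[OF assms, of l] by (subst rotation_def) simp
    also have "\<dots> = f (nat ((int ?j - 1 + l) mod int n) + 1)"
      using j(1) assms by (simp add: rotation_def)
    also have "(int ?j - 1 + l) mod int n = (int i - 1 + (k + l) mod int n) mod int n"
      unfolding j(2) mod_add_left_eq mod_add_right_eq by (simp add: add.assoc)
    also have "f (nat ((int i - 1 + (k + l) mod int n) mod int n) + 1) =
        rotation q n ((k + l) mod int n) f i"
      using True assms by (simp add: rotation_def)
    finally show ?thesis by (rule sym)
  next
    case False
    then have "g i = undefined" if "g \<in> colorings q n" for g
      using that by (auto simp: colorings_def PiE_def extensional_def)
    then show ?thesis
      using assms by (metis rotation_in_colorings)
  qed
qed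

lemma rotation_zero:
  assumes "f \<in> colorings q n"
  shows "rotation q n 0 f = f"
proof
  fix i
  show "rotation q n 0 f i = f i"
  proof (cases "i \<in> {1..n}")
    case True
    then have "nat ((int i - 1 + 0) mod int n) + 1 = i" by auto
    then have "f (nat ((int i - 1 + 0) mod int n) + 1) = f i" by (rule arg_cong)
    then show ?thesis using True assms by (simp add: rotation_def)
  next
    case False
    then show ?thesis using assms by (auto simp: rotation_def colorings_def PiE_def extensional_def)
  qed
qed

lemma group_action_rotation:
  assumes "0 < n"
  shows "group_action (integer_mod_group n) (colorings q n) (rotation q n)"
proof -
  have inv: "rotation q n ((-k) mod int n) (rotation q n k f) = f"
    "rotation q n k (rotation q n ((-k) mod int n) f) = f"
    if "k \<in> {0..<int n}" "f \<in> colorings q n" for k f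
  proof -
    show "rotation q n ((-k) mod int n) (rotation q n k f) = f"
      using rotation_add[OF assms that(2), of "(-k) mod int n" k] rotation_zero[OF that(2)]
      by (simp add: mod_simps)
    show "rotation q n k (rotation q n ((-k) mod int n) f) = f"
      using rotation_add[OF assms that(2), of k "(-k) mod int n"] rotation_zero[OF that(2)]
      by (simp add: mod_simps)
  qed
  have bij: "rotation q n k \<in> Bij (colorings q n)" if "k \<in> {0..<int n}" for k
  proof -
    have "bij_betw (rotation q n k) (colorings q n) (colorings q n)"
      by (rule bij_betw_byWitness[where f' = "rotation q n ((-k) mod int n)"])
        (use inv that rotation_in_colorings[OF assms] in auto)
    then show ?thesis by (simp add: Bij_def rotation_def)
  qed
  have "rotation q n ((k + l) mod int n) = compose (colorings q n) (rotation q n k) (rotation q n l)"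
    for k l
    using rotation_add[OF assms, of _ q k l]
    by (auto simp: compose_def fun_eq_iff rotation_def[of q n "(k + l) mod int n"])
  then have "rotation q n \<in> hom (integer_mod_group n) (BijGroup (colorings q n))"
    using bij assms by (auto simp: hom_def BijGroup_def carrier_integer_mod_group)
  then show ?thesis
    by (simp add: group_action_def group_hom_def group_hom_axioms_def group_BijGroup)
qed

text \<open>The congruence in \<^const>\<open>zero_sum_multisets\<close> is the group-theoretic sum condition.\<close>
lemma fold_integer_mod_group:
  assumes "0 < n"
  shows "fold_mset (monoid.mult (integer_mod_group n)) \<one>\<^bsub>integer_mod_group n\<^esub> M = (\<Sum>\<^sub># M) mod int n"
proof -
  interpret comp_fun_commute "\<lambda>x y. (x + y) mod int n"
    by standard (auto simp: fun_eq_iff mod_simps algebra_simps)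
  show ?thesis by (induction M) (simp_all add: mod_simps)
qed

end

theory Submission
  imports Defs "HOL-Library.Real_Mod"
begin

text \<open>
  Both cardinalities, multiplied by \<open>n\<close>, equal \<open>\<Sum>k<n. q ^ gcd k n\<close>; grouping the \<open>k\<close> by their gcd
  with \<open>n\<close> then yields the totient sum. For necklaces this is Burnside's lemma, since a coloring
  is fixed by rotation by \<open>k\<close> iff it has period \<open>gcd k n\<close>. For multisets, let \<open>w\<close> be a primitive
  \<open>n\<close>-th root of unity: orthogonality of characters gives
  \<open>\<Sum>k<n. \<Prod>j<n. (1 + w^(k*j) + \<dots> + w^(k*j*(q-1)))\<close>. In the \<open>k\<close>-th product the \<open>gcd k n\<close> factors
  with \<open>w^(k*j) = 1\<close> equal \<open>q\<close>, and the others are \<open>(w^(k*j*q) - 1) / (w^(k*j) - 1)\<close>, whose product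
  is 1 because multiplication by \<open>q\<close> permutes the residues \<open>j\<close> modulo \<open>n\<close>.
\<close>

section \<open>Sums over residues grouped by gcd\<close>

text \<open>Exactly \<open>totient (n div d)\<close> of the \<open>k\<close> in
  \<open>{0<..n}\<close> have gcd \<open>d\<close> with \<open>n\<close>; the substitution
  \<open>e = n div d\<close> then gives the stated form.\<close>

lemma sum_gcd_eq_totient_sum:
  fixes f :: "nat \<Rightarrow> 'a::comm_semiring_1"
  assumes "n > 0"
  shows "(\<Sum>k<n. f (gcd k n)) = (\<Sum>e | e dvd n. of_nat (totient e) * f (n div e))"
proof -
  \<comment> \<open>Replacing \<open>k = 0\<close> by \<open>k = n\<close> is harmless because both
    have gcd \<open>n\<close> with \<open>n\<close>; \<open>card_gcd_eq_totient\<close> counts in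
    \<open>{0<..n}\<close>.\<close>
  have "(\<Sum>k<n. f (gcd k n)) = (\<Sum>k\<in>{0<..n}. f (gcd k n))"
    by (rule sum.reindex_bij_witness[of _ "\<lambda>k. if k = n then 0 else k" "\<lambda>k. if k = 0 then n else k"])
      (use assms in auto)
  also have "\<dots> = (\<Sum>d | d dvd n. \<Sum>k | k \<in> {0<..n} \<and> gcd k n = d. f (gcd k n))"
    using assms by (intro sum.group[symmetric]) auto
  also have "\<dots> = (\<Sum>d | d dvd n. of_nat (totient (n div d)) * f d)"
  proof (rule sum.cong)
    fix d assume "d \<in> {d. d dvd n}"
    then have "card {k\<in>{0<..n}. gcd k n = d} = totient (n div d)"
      using assms by (intro card_gcd_eq_totient) simp_all
    then show "(\<Sum>k | k \<in> {0<..n} \<and> gcd k n = d. f (gcd k n)) = of_nat (totient (n div d)) * f d"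
      by simp
  qed simp
  also have "\<dots> = (\<Sum>e | e dvd n. of_nat (totient e) * f (n div e))"
    using assms by (intro sum.reindex_bij_witness[of _ "(div) n" "(div) n"]) (auto elim: dvdE)
  finally show ?thesis .
qed

section \<open>Colorings fixed by a rotation\<close>

lemma periodic_mult:
  fixes F :: "nat \<Rightarrow> 'a"
  assumes "\<And>j. F (j + a) = F j"
  shows "F (j + a * m) = F j"
proof (induction m)
  case (Suc m)
  then show ?case
    using assms[of "j + a * m"] by (simp add: algebra_simps)
qed simp

lemma periodic_mod:
  fixes F :: "nat \<Rightarrow> 'a"
  assumes "\<And>j. F (j + a) = F j"
  shows "F (j mod a) = F j"
  using periodic_mult[of F a "j mod a" "j div a", OF assms] by simp

text \<open>By Bezout in the form \<open>a * x = b * y + gcd a b\<close>, a shift by the gcd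
  followed by \<open>y\<close> shifts by \<open>b\<close> amounts to \<open>x\<close> shifts by
  \<open>a\<close>.\<close>

lemma periodic_gcd:
  fixes F :: "nat \<Rightarrow> 'a"
  assumes a: "\<And>j. F (j + a) = F j" and b: "\<And>j. F (j + b) = F j"
  shows "F (j + gcd a b) = F j"
proof (cases "a = 0")
  case False
  then obtain x y where xy: "a * x = b * y + gcd a b"
    using bezout_nat by blast
  have "F (j + gcd a b) = F (j + gcd a b + b * y)"
    by (rule periodic_mult[of F b, OF b, symmetric])
  also have "j + gcd a b + b * y = j + a * x"
    using xy by simp
  also have "F (j + a * x) = F j"
    by (rule periodic_mult[of F a, OF a])
  finally show ?thesis .
qed (use b in simp)

text \<open>Unrolling the cyclic positions to all naturals makes invariance a periodicity statement,
  to which \<open>periodic_gcd\<close> applies.\<close>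

lemma rotation_eq_self_iff:
  assumes "n > 0" "f \<in> colorings q n"
  shows "rotation q n (int k) f = f \<longleftrightarrow> (\<forall>j. f ((j + k) mod n + 1) = f (j mod n + 1))"
proof
  assume inv: "rotation q n (int k) f = f"
  show "\<forall>j. f ((j + k) mod n + 1) = f (j mod n + 1)"
  proof
    fix j
    have "f (j mod n + 1) = rotation q n (int k) f (j mod n + 1)"
      by (simp add: inv)
    also have "\<dots> = f (nat ((int (j mod n) + int k) mod int n) + 1)"
      using assms by (simp add: rotation_def Suc_le_eq)
    also have "nat ((int (j mod n) + int k) mod int n) = (j + k) mod n"
      by (metis mod_add_left_eq nat_int of_nat_add of_nat_mod)
    finally show "f ((j + k) mod n + 1) = f (j mod n + 1)" ..
  qed
next
  assume per: "\<forall>j. f ((j + k) mod n + 1) = f (j mod n + 1)"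
  show "rotation q n (int k) f = f"
  proof (rule PiE_ext)
    show "rotation q n (int k) f \<in> {1..n} \<rightarrow>\<^sub>E {1..q}" "f \<in> {1..n} \<rightarrow>\<^sub>E {1..q}"
      using rotation_in_colorings[OF assms] assms(2) by (simp_all add: colorings_def)
    fix i assume i: "i \<in> {1..n}"
    then have "nat ((int i - 1 + int k) mod int n) = (i - 1 + k) mod n"
      by (metis atLeastAtMost_iff nat_int of_nat_1 of_nat_add of_nat_diff of_nat_mod)
    then have "rotation q n (int k) f i = f ((i - 1 + k) mod n + 1)"
      using i assms by (simp add: rotation_def)
    also have "\<dots> = f ((i - 1) mod n + 1)"
      using per by blast
    also have "(i - 1) mod n + 1 = i"
      using i by auto
    finally show "rotation q n (int k) f i = f i" .
  qed
qed

text \<open>A fixed coloring has period \<open>gcd k n\<close>, so its first \<open>gcd k n\<close>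
  beads determine it, and these can be chosen freely.\<close>

lemma card_invariants_rotation:
  assumes "n > 0"
  shows "card (invariants (colorings q n) (rotation q n) (int k)) = q ^ gcd k n"
proof -
  let ?g = "gcd k n"
  let ?I = "invariants (colorings q n) (rotation q n) (int k)"
  let ?H = "{1..?g} \<rightarrow>\<^sub>E {1..q}"
  \<comment> \<open>Periodic extension of a word of length \<open>?g\<close>; the shifts by 1
    account for positions starting at 1.\<close>
  let ?ext = "\<lambda>h. \<lambda>i\<in>{1..n}. h ((i - 1) mod ?g + 1)"
  have g: "0 < ?g" "?g \<le> n" "?g dvd k" "?g dvd n"
    using assms by (auto intro: dvd_imp_le)
  have I: "f \<in> colorings q n" "f (j mod ?g + 1) = f (j mod n + 1)" if f: "f \<in> ?I" for f j
  proof -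
    show c: "f \<in> colorings q n"
      using f by (simp add: invariants_def)
    let ?F = "\<lambda>j. f (j mod n + 1)"
    have "?F (j + k) = ?F j" for j
      using f rotation_eq_self_iff[OF assms c] by (simp add: invariants_def)
    \<comment> \<open>The period \<open>k\<close> comes from invariance, the period \<open>n\<close>
      from the reduction modulo \<open>n\<close> in \<open>?F\<close>.\<close>
    then have "?F (j + ?g) = ?F j" for j
      by (rule periodic_gcd[of ?F k n]) simp
    then have "?F (j mod ?g) = ?F j"
      by (rule periodic_mod[of ?F ?g])
    moreover have "j mod ?g < n"
      using g by (meson less_le_trans mod_less_divisor)
    ultimately show "f (j mod ?g + 1) = f (j mod n + 1)"
      by simp
  qed
  have "bij_betw (\<lambda>f. restrict f {1..?g}) ?I ?H"
  proof (rule bij_betw_byWitness[where f' = ?ext])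
    show "\<forall>f\<in>?I. ?ext (restrict f {1..?g}) = f"
    proof
      fix f assume f: "f \<in> ?I"
      show "?ext (restrict f {1..?g}) = f"
      proof
        fix i
        show "?ext (restrict f {1..?g}) i = f i"
        proof (cases "i \<in> {1..n}")
          case True
          then have "(i - 1) mod n + 1 = i" by auto
          moreover have "(i - 1) mod ?g + 1 \<in> {1..?g}"
            using g by (simp add: Suc_le_eq)
          ultimately show ?thesis
            using True I(2)[OF f, of "i - 1"] by simp
        next
          case False
          then show ?thesis
            using I(1)[OF f] by (auto simp: colorings_def PiE_def extensional_def)
        qed
      qed
    qed
    show "\<forall>h\<in>?H. restrict (?ext h) {1..?g} = h"
    proof
      fix h assume h: "h \<in> ?H"
      show "restrict (?ext h) {1..?g} = h"
      proof
        fix i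
        show "restrict (?ext h) {1..?g} i = h i"
        proof (cases "i \<in> {1..?g}")
          case True
          then have "(i - 1) mod ?g + 1 = i" "i \<in> {1..n}"
            using g by auto
          then show ?thesis using True by simp
        qed (use h in \<open>auto simp: PiE_def extensional_def\<close>)
      qed
    qed
    show "(\<lambda>f. restrict f {1..?g}) ` ?I \<subseteq> ?H"
      using I(1) g by (fastforce simp: colorings_def)
    show "?ext ` ?H \<subseteq> ?I"
    proof
      fix f assume "f \<in> ?ext ` ?H"
      then obtain h where h: "h \<in> ?H" and f: "f = ?ext h" by blast
      have r: "j mod ?g + 1 \<in> {1..?g}" for j
        using g by (simp add: Suc_le_eq)
      have c: "f \<in> colorings q n"
        unfolding colorings_def f using h r by (intro restrict_PiE_iff[THEN iffD2] ballI) (rule PiE_mem)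
      have val: "f (j mod n + 1) = h (j mod ?g + 1)" for j
        using assms g(4) by (simp add: f Suc_le_eq mod_mod_cancel)
      have "(j + k) mod ?g = j mod ?g" for j
        using g(3) by (metis add.right_neutral dvd_imp_mod_0 mod_add_right_eq)
      then show "f \<in> ?I"
        using c val rotation_eq_self_iff[OF assms c] by (simp add: invariants_def)
    qed
  qed
  then have "card ?I = card ?H"
    by (rule bij_betw_same_card)
  also have "\<dots> = q ^ ?g"
    by (simp add: card_funcsetE)
  finally show ?thesis .
qed

lemma card_necklaces:
  assumes "n > 0"
  shows "card (necklaces q n) * n = (\<Sum>k<n. q ^ gcd k n)"
proof -
  interpret group_action "integer_mod_group n" "colorings q n" "rotation q n"
    by (rule group_action_rotation[OF assms])
  have carrier: "carrier (integer_mod_group n) = int ` {..<n}"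
    using assms by (simp add: carrier_integer_mod_group lessThan_atLeast0 image_int_atLeastLessThan)
  have "card (necklaces q n) * order (integer_mod_group n) =
      (\<Sum>k\<in>carrier (integer_mod_group n). card (invariants (colorings q n) (rotation q n) k))"
    unfolding necklaces_def
    by (rule burnside) (simp_all add: carrier colorings_def finite_PiE)
  then show ?thesis
    by (simp add: order_def carrier sum.reindex card_image card_invariants_rotation[OF assms])
qed

section \<open>Roots of unity and geometric sums\<close>

text \<open>With \<open>e = n div gcd k n\<close> coprime to \<open>k div gcd k n\<close>, the
  condition becomes \<open>e dvd j\<close>, and \<open>n = e * gcd k n\<close>.\<close>

lemma card_multiples_lessThan:
  fixes n k :: nat
  assumes "n > 0"
  shows "card {j. j < n \<and> n dvd k * j} = gcd k n"
proof -
  let ?g = "gcd k n"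
  define e where "e = n div ?g"
  have e: "n = e * ?g" "e > 0"
    using assms by (simp_all add: e_def div_greater_zero_iff dvd_imp_le)
  have "n dvd k * j \<longleftrightarrow> e dvd j" for j
  proof -
    have "coprime e (k div ?g)"
      unfolding e_def using assms by (metis coprime_commute div_gcd_coprime neq0_conv)
    then have "e dvd j \<longleftrightarrow> e dvd (k div ?g) * j"
      by (simp add: coprime_dvd_mult_right_iff)
    also have "\<dots> \<longleftrightarrow> e * ?g dvd (k div ?g) * j * ?g"
      using assms by simp
    also have "(k div ?g) * j * ?g = k * j"
      by (metis dvd_div_mult_self gcd_dvd1 mult.assoc mult.commute)
    finally show ?thesis using e(1) by simp
  qed
  then have "{j. j < n \<and> n dvd k * j} = {j. j < n \<and> e dvd j}"
    by simp
  also have "\<dots> = (\<lambda>i. e * i) ` {..<?g}"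
  proof (intro equalityI subsetI)
    fix j assume "j \<in> {j. j < n \<and> e dvd j}"
    then obtain i where "j = e * i" "e * i < e * ?g"
      using e(1) by auto
    then show "j \<in> (\<lambda>i. e * i) ` {..<?g}" by auto
  next
    fix j assume "j \<in> (\<lambda>i. e * i) ` {..<?g}"
    then obtain i where "j = e * i" "i < ?g" by auto
    moreover from this have "e * i < e * ?g" using e(2) by simp
    ultimately show "j \<in> {j. j < n \<and> e dvd j}" using e(1) by simp
  qed
  also have "card \<dots> = ?g"
    using e(2) by (subst card_image) (auto simp: inj_on_def)
  finally show ?thesis .
qed

lemma primitive_root_of_unity_power_eq_1_iff:
  assumes "n > 0"
  shows "cis (2 * pi / real n) ^ m = 1 \<longleftrightarrow> n dvd m"
proof -
  have "cis (2 * pi / real n) ^ m = 1 \<longleftrightarrow> (\<exists>i::int. real m = of_int i * real n)"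
    using assms by (simp add: DeMoivre cis_eq_1_iff field_simps)
  also have "\<dots> \<longleftrightarrow> (\<exists>i::int. int m = int n * i)"
    by (metis mult.commute of_int_eq_iff of_int_mult of_int_of_nat_eq)
  also have "\<dots> \<longleftrightarrow> n dvd m"
    by (simp add: dvd_def[symmetric])
  finally show ?thesis .
qed

lemma prod_geometric_sums_roots_of_unity:
  fixes w :: complex
  assumes n: "n > 0" and "coprime q n" and w: "\<And>m. w ^ m = 1 \<longleftrightarrow> n dvd m"
  shows "(\<Prod>j<n. \<Sum>i<q. w ^ (k * j * i)) = of_nat (q ^ gcd k n)"
proof -
  define Z where "Z = {j. j < n \<and> n dvd k * j}"
  define J where "J = {j. j < n \<and> \<not> n dvd k * j}"
  let ?s = "\<lambda>j. \<Sum>i<q. w ^ (k * j * i)"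
  have fin: "finite Z" "finite J" by (simp_all add: Z_def J_def)
  have "?s j = of_nat q" if "j \<in> Z" for j
  proof -
    have "w ^ (k * j * i) = 1" for i
      using that by (simp add: Z_def w)
    then show ?thesis by simp
  qed
  then have Z: "(\<Prod>j\<in>Z. ?s j) = of_nat (q ^ gcd k n)"
    using card_multiples_lessThan[OF n, of k] by (simp add: Z_def)
  \<comment> \<open>Multiplication by \<open>q\<close> permutes \<open>J\<close>, so numerators and denominators of the
    geometric sums have the same product.\<close>
  have dvd: "n dvd k * (q * j mod n) \<longleftrightarrow> n dvd k * j" for j
  proof -
    have "n dvd k * (q * j mod n) \<longleftrightarrow> n dvd k * (q * j)"
      by (metis dvd_eq_mod_eq_0 mod_mult_right_eq)
    also have "\<dots> \<longleftrightarrow> n dvd q * (k * j)"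
      by (simp add: ac_simps)
    finally show ?thesis
      using \<open>coprime q n\<close> by (simp add: coprime_commute coprime_dvd_mult_right_iff)
  qed
  have inj: "inj_on (\<lambda>j. q * j mod n) J"
  proof (rule inj_onI)
    fix i j assume ij: "i \<in> J" "j \<in> J" "q * i mod n = q * j mod n"
    then have "[i = j] (mod n)"
      using \<open>coprime q n\<close> cong_mult_lcancel_nat[of q n i j] by (simp add: cong_def)
    then show "i = j"
      using ij by (simp add: cong_def J_def)
  qed
  have "(\<lambda>j. q * j mod n) ` J \<subseteq> J"
    using n by (auto simp: J_def dvd)
  then have "(\<lambda>j. q * j mod n) ` J = J"
    using fin(2) inj by (intro endo_inj_surj)
  then have "bij_betw (\<lambda>j. q * j mod n) J J"
    using inj by (simp add: bij_betw_def)
  then have "(\<Prod>j\<in>J. w ^ (k * (q * j mod n)) - 1) = (\<Prod>j\<in>J. w ^ (k * j) - 1)"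
    by (rule prod.reindex_bij_betw)
  moreover have "w ^ (k * (q * j mod n)) = w ^ (k * j * q)" for j
  proof -
    have wn: "w ^ n = 1" by (simp add: w)
    have "k * (q * j) = k * (q * j mod n) + n * (k * (q * j div n))"
      by (metis distrib_left mod_mult_div_eq mult.left_commute)
    then have "w ^ (k * (q * j)) = w ^ (k * (q * j mod n) + n * (k * (q * j div n)))"
      by (rule arg_cong)
    also have "\<dots> = w ^ (k * (q * j mod n))"
      by (simp add: power_add power_mult[of w n] wn)
    finally show ?thesis by (simp add: ac_simps)
  qed
  moreover have "w ^ (k * j * q) - 1 = (w ^ (k * j) - 1) * ?s j" for j
    using power_diff_1_eq[of "w ^ (k * j)" q] by (simp add: power_mult)
  \<comment> \<open>The quotient formula is kept in multiplied form; the common factor is cancelled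
    only once it is known to be nonzero, by the definition of \<open>J\<close>.\<close>
  ultimately have "(\<Prod>j\<in>J. w ^ (k * j) - 1) * (\<Prod>j\<in>J. ?s j) = (\<Prod>j\<in>J. w ^ (k * j) - 1)"
    by (simp add: prod.distrib)
  moreover have "(\<Prod>j\<in>J. w ^ (k * j) - 1) \<noteq> 0"
    using fin(2) by (simp add: J_def w)
  ultimately have J: "(\<Prod>j\<in>J. ?s j) = 1"
    by simp
  have "{..<n} = Z \<union> J" "Z \<inter> J = {}"
    by (auto simp: Z_def J_def)
  then show ?thesis
    using fin Z J by (simp add: prod.union_disjoint)
qed

text \<open>Multiplying the geometric sum by \<open>w ^ m - 1\<close> telescopes it to
  \<open>w ^ (m * n) - 1 = 0\<close>, so either the ratio is 1 or the sum vanishes.\<close>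

lemma sum_root_of_unity_powers:
  fixes w :: complex
  assumes w: "\<And>m. w ^ m = 1 \<longleftrightarrow> n dvd m"
  shows "(\<Sum>k<n. w ^ (k * m)) = (if n dvd m then of_nat n else 0)"
proof -
  have "(w ^ m - 1) * (\<Sum>k<n. w ^ (k * m)) = w ^ (m * n) - 1"
    using power_diff_1_eq[of "w ^ m" n] by (simp add: mult.commute[of _ m] power_mult)
  also have "\<dots> = 0"
    by (simp add: w)
  finally have "w ^ m = 1 \<or> (\<Sum>k<n. w ^ (k * m)) = 0"
    by simp
  moreover have "(\<Sum>k<n. w ^ (k * m)) = of_nat n" if "n dvd m"
  proof -
    have "w ^ (k * m) = 1" for k
      using that by (simp add: w)
    then show ?thesis by simp
  qed
  ultimately show ?thesis
    by (auto simp: w)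
qed

section \<open>Counting zero-sum multisets with characters\<close>

text \<open>Multisets are encoded by their multiplicity functions, so that sums over them range over
  a product set and can be factored.\<close>

lemma card_zero_sum_multisets_functions:
  assumes "n > 0"
  shows "card (zero_sum_multisets q n) =
    card {c \<in> {..<n} \<rightarrow>\<^sub>E {..<q}. n dvd (\<Sum>j<n. j * c j)}"
    (is "_ = card ?C")
proof -
  let ?count = "\<lambda>M. \<lambda>j\<in>{..<n}. count M (int j)"
  let ?mset = "\<lambda>c. \<Sum>j<n. replicate_mset (c j) (int j)"
  have sum_iff: "[\<Sum>\<^sub># (?mset c) = 0] (mod int n) \<longleftrightarrow> n dvd (\<Sum>j<n. j * c j)" for c
  proof -
    have "\<Sum>\<^sub># (\<Sum>j<m. replicate_mset (c j) (int j)) = int (\<Sum>j<m. j * c j)" for m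
      by (induction m) (simp_all add: mult.commute)
    then show ?thesis by (simp only: cong_0_iff int_dvd_int_iff)
  qed
  have count: "count (?mset c) x = (if 0 \<le> x \<and> x < int n then c (nat x) else 0)" for c x
  proof -
    \<comment> \<open>The guard \<open>0 \<le> x\<close> is essential since \<open>nat\<close> sends
      negative integers to 0.\<close>
    have "count (?mset c) x = (\<Sum>j<n. if j = nat x \<and> 0 \<le> x then c j else 0)"
      unfolding count_sum by (intro sum.cong) auto
    then show ?thesis by (auto simp: nat_less_iff)
  qed
  have mset_count: "?mset (?count M) = M" if "set_mset M \<subseteq> {0..<int n}" for M
  proof (rule multiset_eqI)
    fix x
    show "count (?mset (?count M)) x = count M x"
      using that by (force simp: count count_eq_zero_iff nat_less_iff)
  qed
  have "bij_betw ?count (zero_sum_multisets q n) ?C"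
  proof (rule bij_betw_byWitness[where f' = ?mset])
    show "\<forall>M\<in>zero_sum_multisets q n. ?mset (?count M) = M"
      using mset_count assms by (simp add: zero_sum_multisets_def carrier_integer_mod_group)
    show "\<forall>c\<in>?C. ?count (?mset c) = c"
      by (auto simp: count fun_eq_iff PiE_def extensional_def)
    show "?count ` zero_sum_multisets q n \<subseteq> ?C"
    proof
      fix c assume "c \<in> ?count ` zero_sum_multisets q n"
      then obtain M where M: "M \<in> zero_sum_multisets q n" and c: "c = ?count M"
        by blast
      then have "?mset c = M"
        using mset_count assms by (simp add: zero_sum_multisets_def carrier_integer_mod_group)
      then have "n dvd (\<Sum>j<n. j * c j)"
        using M sum_iff[of c] by (simp add: zero_sum_multisets_def)
      moreover have "c \<in> {..<n} \<rightarrow>\<^sub>E {..<q}"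
        using M by (simp add: c zero_sum_multisets_def)
      ultimately show "c \<in> ?C" by simp
    qed
    show "?mset ` ?C \<subseteq> zero_sum_multisets q n"
    proof
      fix M assume "M \<in> ?mset ` ?C"
      then obtain c where c: "c \<in> ?C" and M: "M = ?mset c" by blast
      have less: "c j < q" if "j < n" for j
        using c that PiE_mem[of c "{..<n}" "\<lambda>_. {..<q}" j] by simp
      \<comment> \<open>The multiplicity bound also concerns elements outside the multiset, whose
        count is 0.\<close>
      then have "0 < q"
        using assms by fastforce
      then have "count M x < q" for x
        using less[of "nat x"] unfolding M count by (simp add: nat_less_iff)
      moreover have "set_mset M \<subseteq> {0..<int n}"
      proof
        fix x assume "x \<in># M"
        then have "count M x \<noteq> 0" by simp
        then show "x \<in> {0..<int n}"
          unfolding M count by (simp split: if_splits)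
      qed
      moreover have "[\<Sum>\<^sub># M = 0] (mod int n)"
        unfolding M sum_iff using c by simp
      ultimately show "M \<in> zero_sum_multisets q n"
        using assms by (simp add: zero_sum_multisets_def carrier_integer_mod_group)
    qed
  qed
  then show ?thesis by (rule bij_betw_same_card)
qed

lemma card_zero_sum_multisets:
  assumes n: "n > 0" and "coprime q n"
  shows "card (zero_sum_multisets q n) * n = (\<Sum>k<n. q ^ gcd k n)"
proof -
  define w where "w = cis (2 * pi / real n)"
  have w: "w ^ m = 1 \<longleftrightarrow> n dvd m" for m
    unfolding w_def using n by (rule primitive_root_of_unity_power_eq_1_iff)
  let ?C = "{..<n} \<rightarrow>\<^sub>E {..<q}"
  let ?S = "\<lambda>c. \<Sum>j<n. j * c j"
  have fin: "finite ?C" by (simp add: finite_PiE)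
  have "complex_of_nat (card (zero_sum_multisets q n) * n) = (\<Sum>c | c \<in> ?C \<and> n dvd ?S c. of_nat n)"
    by (simp add: card_zero_sum_multisets_functions[OF n])
  also have "\<dots> = (\<Sum>c\<in>?C. if n dvd ?S c then of_nat n else 0)"
    using fin by (rule sum.inter_filter)
  \<comment> \<open>Orthogonality turns the divisibility condition into a sum over characters; this
    is where the factor \<open>n\<close> is absorbed.\<close>
  also have "\<dots> = (\<Sum>c\<in>?C. \<Sum>k<n. w ^ (k * ?S c))"
    by (simp only: sum_root_of_unity_powers[OF w])
  also have "\<dots> = (\<Sum>k<n. \<Sum>c\<in>?C. w ^ (k * ?S c))"
    by (rule sum.swap)
  also have "\<dots> = (\<Sum>k<n. \<Sum>c\<in>?C. \<Prod>j<n. w ^ (k * j * c j))"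
    by (simp add: sum_distrib_left power_sum mult.assoc)
  \<comment> \<open>Each multiplicity \<open>c j\<close> varies independently, so the sum over
    \<open>?C\<close> factors over \<open>j\<close>.\<close>
  also have "\<dots> = (\<Sum>k<n. \<Prod>j<n. \<Sum>i<q. w ^ (k * j * i))"
    by (simp add: prod_sum_PiE)
  also have "\<dots> = (\<Sum>k<n. of_nat (q ^ gcd k n))"
    by (simp only: prod_geometric_sums_roots_of_unity[OF assms w])
  also have "\<dots> = of_nat (\<Sum>k<n. q ^ gcd k n)"
    by simp
  finally show ?thesis
    by (simp only: of_nat_eq_iff)
qed

theorem theorem3p4:
  fixes q n :: nat
  assumes "0 < q" and "0 < n" and "coprime q n"
  shows "card (necklaces q n) = card (zero_sum_multisets q n) \<and>
         real (card (zero_sum_multisets q n)) =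
           1 / real n * (\<Sum>e | e dvd n. real (totient e) * real q ^ (n div e))"
proof
  have "card (necklaces q n) * n = card (zero_sum_multisets q n) * n"
    using assms by (simp add: card_necklaces card_zero_sum_multisets)
  then show "card (necklaces q n) = card (zero_sum_multisets q n)"
    using assms by simp
  have "real (card (zero_sum_multisets q n)) * real n = real (\<Sum>k<n. q ^ gcd k n)"
    using assms by (simp flip: card_zero_sum_multisets)
  also have "\<dots> = (\<Sum>k<n. real q ^ gcd k n)"
    by simp
  also have "\<dots> = (\<Sum>e | e dvd n. real (totient e) * real q ^ (n div e))"
    using assms by (simp add: sum_gcd_eq_totient_sum)
  finally show "real (card (zero_sum_multisets q n)) =
      1 / real n * (\<Sum>e | e dvd n. real (totient e) * real q ^ (n div e))"
    using assms by (simp add: field_simps)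
qed

end
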